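(* Let $\{G_i\}_{i\in I}$ be an HS-frame for $\mathcal{H}$ with respect to $\mathcal{K}$ with bounds $A,B$, and let $\{H_i\}_{i\in I}$ be a family of bounded linear operators from $\mathcal{H}$ into $\mathcal{C}_2(\mathcal{K})$. Assume there exist constants $\alpha,\beta\in(0,1)$ satisfying $\alpha+\beta=1$, and constants $\lambda_1,\lambda_2\geq 0$ satisfying $\max\{\lambda_1,\lambda_2\}<1$, such that for every finite subset $J\subseteq I$ and all $A_i\in\mathcal{C}_2(\mathcal{K})$ $(i\in J)$, $$\Big\|\sum_{i\in J}(G_i^*A_i-H_i^*A_i)\Big\|\leq\lambda_1\Big\|\sum_{i\in J}G_i^*A_i\Big\|^\alpha\Big\|\sum_{i\in J}H_i^*A_i\Big\|^\beta+\lambda_2\Big\|\sum_{i\in J}G_i^*A_i\Big\|^\beta\Big\|\sum_{i\in J}H_i^*A_i\Big\|^\alpha.$$ Then $\{H_i\}_{i\in I}$ is an HS-frame for $\mathcal{H}$ with respect to $\mathcal{K}$ with (lower and upper, respectively) frame bounds $$A\left(\frac{1-\alpha\lambda_1-\beta\lambda_2}{1+\beta\lambda_1+\alpha\lambda_2}\right)^2\quad\text{and}\quad B\left(\frac{1+\alpha\lambda_1+\beta\lambda_2}{1-\beta\lambda_1-\alpha\lambda_2}\right)^2.$$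
   Context: $\mathcal{H}$ and $\mathcal{K}$ are separable Hilbert spaces and $I$ is a countable index set. $\mathcal{C}_2(\mathcal{K})$ is the Hilbert-Schmidt class: all compact operators $T$ on $\mathcal{K}$ with $\sum_j\|Te_j\|^2<\infty$, where $\{e_j\}$ is an orthonormal basis of $\mathcal{K}$; it is a Hilbert space with inner product $[T,S]_{\mathrm{tr}}=\mathrm{trace}(S^*T)=\sum_j\langle Te_j,Se_j\rangle$ and norm $\|T\|_2=[T,T]_{\mathrm{tr}}^{1/2}$. For a bounded linear operator $G:\mathcal{H}\to\mathcal{C}_2(\mathcal{K})$, the adjoint $G^*:\mathcal{C}_2(\mathcal{K})\to\mathcal{H}$ is determined by $[Gx,T]_{\mathrm{tr}}=\langle x,G^*T\rangle$ for all $x\in\mathcal{H}$, $T\in\mathcal{C}_2(\mathcal{K})$. A family $\{G_i\}_{i\in I}$ of bounded linear operators from $\mathcal{H}$ into $\mathcal{C}_2(\mathcal{K})$ is a Hilbert-Schmidt frame (HS-frame) for $\mathcal{H}$ with respect to $\mathcal{K}$ with (frame) bounds $A,B$ if $A,B>0$ and $$A\|x\|^2\leq\sum_{i\in I}\|G_ix\|_2^2\leq B\|x\|^2\quad\text{for all }x\in\mathcal{H};$$ $A$ is the lower and $B$ the upper frame bound (bounds are not required to be optimal). The scalar $A$ (a frame bound) is unrelated to the operators $A_i\in\mathcal{C}_2(\mathcal{K})$. *)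

theory Defs
  imports "HOL-Analysis.Analysis"
begin

class complex_vector = real_vector +
  fixes scaleC :: "complex \<Rightarrow> 'a \<Rightarrow> 'a" (infixr "*\<^sub>C" 75)
  assumes scaleC_add_right: "c *\<^sub>C (x + y) = c *\<^sub>C x + c *\<^sub>C y"
    and scaleC_add_left: "(c + d) *\<^sub>C x = c *\<^sub>C x + d *\<^sub>C x"
    and scaleC_scaleC: "c *\<^sub>C d *\<^sub>C x = (c * d) *\<^sub>C x"
    and scaleC_of_real: "complex_of_real r *\<^sub>C x = r *\<^sub>R x"

lemma scaleC_one [simp]: "1 *\<^sub>C x = (x :: 'a::complex_vector)"
  using scaleC_of_real [of 1 x] by simp

global_interpretation cvs: vector_space "scaleC :: complex \<Rightarrow> 'a \<Rightarrow> 'a::complex_vector"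
  by unfold_locales
    (simp_all add: scaleC_add_right scaleC_add_left scaleC_scaleC)

class complex_inner = complex_vector + real_normed_vector +
  fixes cinner :: "'a \<Rightarrow> 'a \<Rightarrow> complex"
  assumes cinner_commute: "cinner x y = cnj (cinner y x)"
    and cinner_add_left: "cinner (x + y) z = cinner x z + cinner y z"
    and cinner_scaleC_left: "cinner (c *\<^sub>C x) y = c * cinner x y"
    and cinner_norm: "cinner x x = complex_of_real ((norm x)\<^sup>2)"

class chilbert_space = complex_inner + complete_space

subclass (in chilbert_space) banach ..

definition bounded_clinear :: "('a::complex_inner \<Rightarrow> 'b::complex_inner) \<Rightarrow> bool" where
  "bounded_clinear f \<longleftrightarrow> bounded_linear f \<and> (\<forall>c x. f (c *\<^sub>C x) = c *\<^sub>C f x)"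

definition cadjoint :: "('a::complex_inner \<Rightarrow> 'b::complex_inner) \<Rightarrow> 'b \<Rightarrow> 'a" where
  "cadjoint f t = (THE y. \<forall>x. cinner (f x) t = cinner x y)"

definition is_onb :: "'a::complex_inner set \<Rightarrow> bool" where
  "is_onb E \<longleftrightarrow> (\<forall>e\<in>E. \<forall>f\<in>E. cinner e f = (if e = f then 1 else 0))
     \<and> closure (cvs.span E) = UNIV"

lemma cinner_add_right: "cinner z (x + y) = cinner z x + cinner z (y :: 'a::complex_inner)"
  by (metis cinner_commute cinner_add_left complex_cnj_add)

lemma cinner_scaleC_right: "cinner y (c *\<^sub>C x) = cnj c * cinner y (x :: 'a::complex_inner)"
  by (metis cinner_commute cinner_scaleC_left complex_cnj_mult)

lemma cinner_zero_left [simp]: "cinner 0 (y :: 'a::complex_inner) = 0"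
  using cinner_add_left [of 0 0 y] by simp

lemma cinner_zero_right [simp]: "cinner (y :: 'a::complex_inner) 0 = 0"
  using cinner_add_right [of y 0 0] by simp

lemma cinner_diff_left: "cinner (x - y) z = cinner x z - cinner y (z :: 'a::complex_inner)"
  using cinner_add_left [of "x - y" y z] by (simp add: algebra_simps)

lemma cinner_diff_right: "cinner z (x - y) = cinner z x - cinner z (y :: 'a::complex_inner)"
  using cinner_add_right [of z "x - y" y] by (simp add: algebra_simps)

lemma norm_scaleC: "norm (c *\<^sub>C x) = cmod c * norm (x :: 'a::complex_inner)"
proof -
  have "complex_of_real ((norm (c *\<^sub>C x))\<^sup>2) = c * cnj c * cinner x x"
    unfolding cinner_norm [symmetric] by (simp add: cinner_scaleC_left cinner_scaleC_right)
  also have "\<dots> = complex_of_real ((cmod c * norm x)\<^sup>2)"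
    by (simp only: cinner_norm complex_norm_square [symmetric] of_real_mult [symmetric]
        power_mult_distrib)
  finally have "(norm (c *\<^sub>C x))\<^sup>2 = (cmod c * norm x)\<^sup>2"
    by (simp only: of_real_eq_iff)
  then show ?thesis
    by (simp add: power2_eq_iff_nonneg)
qed

lemma norm_projection_sq:
  fixes z s :: "'a::complex_inner"
  assumes "s \<noteq> 0"
  shows "(norm (z - (cinner z s / of_real ((norm s)\<^sup>2)) *\<^sub>C s))\<^sup>2
       = (norm z)\<^sup>2 - (cmod (cinner z s))\<^sup>2 / (norm s)\<^sup>2"
proof -
  define c where "c = cinner z s / complex_of_real ((norm s)\<^sup>2)"
  have n: "complex_of_real ((norm s)\<^sup>2) \<noteq> 0"
    using assms by simp
  have 1: "cinner s z = cnj (cinner z s)"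
    by (rule cinner_commute)
  have 2: "c * complex_of_real ((norm s)\<^sup>2) = cinner z s"
    unfolding c_def using n by simp
  have "cinner (z - c *\<^sub>C s) (z - c *\<^sub>C s) =
     cinner z z - cnj c * cinner z s
       - (c * cinner s z - c * (cnj c * complex_of_real ((norm s)\<^sup>2)))"
    by (simp add: cinner_diff_left cinner_diff_right cinner_scaleC_left cinner_scaleC_right
        cinner_norm [of s] right_diff_distrib del: of_real_power)
  also have "c * (cnj c * complex_of_real ((norm s)\<^sup>2)) = cnj c * cinner z s"
    using 2 by (metis mult.left_commute)
  also have "c * cinner s z = cinner z s * cnj (cinner z s) / complex_of_real ((norm s)\<^sup>2)"
    by (simp add: c_def 1)
  also have "\<dots> = complex_of_real ((cmod (cinner z s))\<^sup>2 / (norm s)\<^sup>2)"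
    by (simp only: complex_norm_square [symmetric] of_real_divide)
  finally have "complex_of_real ((norm (z - c *\<^sub>C s))\<^sup>2)
      = complex_of_real ((norm z)\<^sup>2 - (cmod (cinner z s))\<^sup>2 / (norm s)\<^sup>2)"
    by (simp add: cinner_norm del: of_real_power of_real_divide)
  then show ?thesis
    unfolding c_def by (simp only: of_real_eq_iff)
qed

lemma cinner_Cauchy_Schwarz: "cmod (cinner x y) \<le> norm x * norm (y :: 'a::complex_inner)"
proof (cases "y = 0")
  case False
  have "0 \<le> (norm x)\<^sup>2 - (cmod (cinner x y))\<^sup>2 / (norm y)\<^sup>2"
    unfolding norm_projection_sq [OF False, symmetric] by simp
  then have "(cmod (cinner x y))\<^sup>2 \<le> (norm x * norm y)\<^sup>2"
    using False by (simp add: field_simps)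
  then show ?thesis
    by (rule power2_le_imp_le) simp
qed simp

lemma parallelogram:
  "(norm (a + b))\<^sup>2 + (norm (a - b))\<^sup>2 = 2 * (norm a)\<^sup>2 + 2 * (norm (b :: 'a::complex_inner))\<^sup>2"
proof -
  have "cinner (a + b) (a + b) + cinner (a - b) (a - b) = 2 * cinner a a + 2 * cinner b b"
    by (simp add: cinner_diff_left cinner_diff_right cinner_add_left cinner_add_right)
  then have "complex_of_real ((norm (a + b))\<^sup>2 + (norm (a - b))\<^sup>2)
    = complex_of_real (2 * (norm a)\<^sup>2 + 2 * (norm b)\<^sup>2)"
    by (simp only: cinner_norm of_real_add of_real_mult of_real_numeral)
  then show ?thesis
    by (simp only: of_real_eq_iff)
qed

lemma bounded_linear_scaleC: "bounded_linear ((*\<^sub>C) c :: 'a \<Rightarrow> 'a::complex_inner)"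
  by (rule bounded_linear_intro [where K = "cmod c"])
    (simp_all add: scaleC_add_right scaleC_scaleC norm_scaleC mult.commute
      flip: scaleC_of_real)

lemma bounded_linear_cinner_left: "bounded_linear (\<lambda>x. cinner x (y :: 'a::complex_inner))"
  by (rule bounded_linear_intro [where K = "norm y"])
    (simp_all add: cinner_add_left cinner_scaleC_left cinner_Cauchy_Schwarz
      scaleR_conv_of_real flip: scaleC_of_real)

lemma bounded_linear_cinner_right: "bounded_linear (\<lambda>x. cinner (y :: 'a::complex_inner) x)"
  by (rule bounded_linear_intro [where K = "norm y"])
    (simp_all add: cinner_add_right cinner_scaleC_right cinner_Cauchy_Schwarz mult.commute
      scaleR_conv_of_real cinner_Cauchy_Schwarz [of y, unfolded mult.commute [of "norm y"]]
      flip: scaleC_of_real)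

lemma closest_point_exists:
  fixes S :: "'a::chilbert_space set"
  assumes cl: "closed S" and sub: "cvs.subspace S"
  obtains y where "y \<in> S" "\<And>s. s \<in> S \<Longrightarrow> norm (x - y) \<le> norm (x - s)"
proof -
  have ne: "S \<noteq> {}"
    using cvs.subspace_0 [OF sub] by auto
  define d where "d = (INF s\<in>S. norm (x - s))"
  have bdd: "bdd_below ((\<lambda>s. norm (x - s)) ` S)"
    by (rule bdd_belowI2 [of _ 0]) simp
  have d_le: "d \<le> norm (x - s)" if "s \<in> S" for s
    unfolding d_def using bdd that by (rule cINF_lower)
  have d0: "0 \<le> d"
    unfolding d_def using ne by (intro cINF_greatest) auto
  have "\<exists>s\<in>S. norm (x - s) < d + e" if "e > 0" for e
    using that ne bdd unfolding d_def by (subst cINF_less_iff [symmetric]) auto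
  then have "\<exists>f. \<forall>n. f n \<in> S \<and> norm (x - f n) < d + 1 / Suc n"
    by (intro choice) (meson of_nat_0_less_iff zero_less_Suc zero_less_divide_1_iff)
  then obtain f where fS: "\<And>n. f n \<in> S" and fd: "\<And>n::nat. norm (x - f n) < d + 1 / Suc n"
    by auto
  have lim: "(\<lambda>n. norm (x - f n)) \<longlonglongrightarrow> d"
  proof (rule tendsto_sandwich)
    show "(\<lambda>n. d) \<longlonglongrightarrow> d" by simp
    show "(\<lambda>n. d + 1 / Suc n) \<longlonglongrightarrow> d"
      using tendsto_add [OF tendsto_const LIMSEQ_inverse_real_of_nat, of d]
      by (simp add: inverse_eq_divide)
    show "\<forall>\<^sub>F n in sequentially. d \<le> norm (x - f n)"
      using d_le fS by simp
    show "\<forall>\<^sub>F n in sequentially. norm (x - f n) \<le> d + 1 / Suc n"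
      using fd by (intro always_eventually allI less_imp_le)
  qed
  have key: "(norm (f m - f n))\<^sup>2 \<le> 2 * (norm (x - f m))\<^sup>2 + 2 * (norm (x - f n))\<^sup>2 - 4 * d\<^sup>2" for m n
  proof -
    define s where "s = (1/2) *\<^sub>R (f m + f n)"
    have "s = complex_of_real (1/2) *\<^sub>C (f m + f n)"
      unfolding s_def by (rule scaleC_of_real [symmetric])
    then have "s \<in> S"
      using sub fS by (simp add: cvs.subspace_add cvs.subspace_scale)
    then have "d\<^sup>2 \<le> (norm (x - s))\<^sup>2"
      using d_le d0 by (simp add: power_mono)
    moreover have "(x - f m) + (x - f n) = 2 *\<^sub>R (x - s)"
      unfolding s_def by (simp add: scaleR_diff_right scaleR_2)
    then have "norm ((x - f m) + (x - f n)) = 2 * norm (x - s)"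
      by simp
    moreover have "norm ((x - f m) - (x - f n)) = norm (f m - f n)"
      by (simp add: norm_minus_commute)
    ultimately show ?thesis
      using parallelogram [of "x - f m" "x - f n"] by (simp add: power_mult_distrib)
  qed
  have "Cauchy f"
  proof (rule metric_CauchyI)
    fix e :: real assume "e > 0"
    have "(\<lambda>n. (norm (x - f n))\<^sup>2) \<longlonglongrightarrow> d\<^sup>2"
      using lim by (intro tendsto_power)
    moreover have "d\<^sup>2 < d\<^sup>2 + e\<^sup>2 / 4"
      using \<open>e > 0\<close> by simp
    ultimately have "eventually (\<lambda>n. (norm (x - f n))\<^sup>2 < d\<^sup>2 + e\<^sup>2 / 4) sequentially"
      by (rule order_tendstoD)
    then obtain N where N: "\<And>n. n \<ge> N \<Longrightarrow> (norm (x - f n))\<^sup>2 < d\<^sup>2 + e\<^sup>2 / 4"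
      by (auto simp: eventually_sequentially)
    have "dist (f m) (f n) < e" if "m \<ge> N" "n \<ge> N" for m n
    proof -
      have "(norm (f m - f n))\<^sup>2 < e\<^sup>2"
        using key [of m n] N [OF that(1)] N [OF that(2)] by simp
      then show ?thesis
        using \<open>e > 0\<close> by (simp add: dist_norm power2_less_imp_less)
    qed
    then show "\<exists>M. \<forall>m\<ge>M. \<forall>n\<ge>M. dist (f m) (f n) < e"
      by blast
  qed
  then obtain y where y: "f \<longlonglongrightarrow> y"
    using Cauchy_convergent convergent_def by blast
  have "y \<in> S"
    using closed_sequentially [OF cl] fS y by blast
  moreover have "(\<lambda>n. norm (x - f n)) \<longlonglongrightarrow> norm (x - y)"
    using y by (intro tendsto_intros)
  then have "norm (x - y) = d"
    using lim by (rule LIMSEQ_unique)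
  ultimately show ?thesis
    using that d_le by auto
qed

lemma closed_subspace_complement:
  fixes S :: "'a::chilbert_space set"
  assumes cl: "closed S" and sub: "cvs.subspace S" and x: "x \<notin> S"
  obtains z where "z \<noteq> 0" "\<And>s. s \<in> S \<Longrightarrow> cinner z s = 0"
proof -
  obtain y where y: "y \<in> S" "\<And>s. s \<in> S \<Longrightarrow> norm (x - y) \<le> norm (x - s)"
    using closest_point_exists [OF cl sub] by blast
  have "cinner (x - y) s = 0" if s: "s \<in> S" for s
  proof (cases "s = 0")
    case False
    let ?c = "cinner (x - y) s / of_real ((norm s)\<^sup>2)"
    have "y + ?c *\<^sub>C s \<in> S"
      using sub y(1) s by (simp add: cvs.subspace_add cvs.subspace_scale)
    then have "norm (x - y) \<le> norm ((x - y) - ?c *\<^sub>C s)"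
      using y(2) by (metis diff_diff_eq)
    then have "(norm (x - y))\<^sup>2 \<le> (norm ((x - y) - ?c *\<^sub>C s))\<^sup>2"
      by (simp add: power_mono)
    then have "(cmod (cinner (x - y) s))\<^sup>2 / (norm s)\<^sup>2 \<le> 0"
      unfolding norm_projection_sq [OF False] by simp
    then show ?thesis
      using False by (simp add: divide_le_0_iff)
  qed simp
  moreover have "x - y \<noteq> 0"
    using x y(1) by auto
  ultimately show ?thesis
    using that by blast
qed

lemma cinner_right_eqI:
  assumes "\<And>x. cinner x y = cinner x (y' :: 'a::complex_inner)"
  shows "y = y'"
proof -
  have "cinner (y - y') (y - y') = 0"
    unfolding cinner_diff_right using assms by simp
  then show ?thesis
    by (simp add: cinner_norm)
qed

lemma cadjoint_exists:
  fixes f :: "'a::chilbert_space \<Rightarrow> 'b::complex_inner"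
  assumes "bounded_clinear f"
  shows "\<exists>y. \<forall>x. cinner (f x) t = cinner x y"
proof (cases "\<forall>x. cinner (f x) t = 0")
  case True
  then show ?thesis
    by (intro exI [of _ 0]) simp
next
  case False
  let ?S = "{x. cinner (f x) t = 0}"
  have bl: "bounded_linear f" and sc: "\<And>c x. f (c *\<^sub>C x) = c *\<^sub>C f x"
    using assms by (auto simp: bounded_clinear_def)
  have bl': "bounded_linear (\<lambda>x. cinner (f x) t)"
    by (rule bounded_linear_compose [OF bounded_linear_cinner_left bl])
  have sub: "cvs.subspace ?S"
    using bl sc
    by (auto simp: cvs.subspace_def linear_simps cinner_add_left cinner_scaleC_left)
  have cl: "closed ?S"
    using linear_continuous_on [OF bl', of UNIV]
    by (intro closed_Collect_eq) (auto intro: continuous_intros)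
  from False obtain x0 where "x0 \<notin> ?S"
    by auto
  then obtain z where z: "z \<noteq> 0" "\<And>s. s \<in> ?S \<Longrightarrow> cinner z s = 0"
    using closed_subspace_complement [OF cl sub] by blast
  define n p where "n = cinner z z" and "p = cinner (f z) t"
  have n0: "n \<noteq> 0"
    using z(1) by (simp add: n_def cinner_norm)
  have p0: "p \<noteq> 0"
    using n0 z(2) [of z] unfolding n_def p_def by auto
  have "cinner (f x) t = cinner x (cnj (p / n) *\<^sub>C z)" for x
  proof -
    let ?s = "x - (cinner (f x) t / p) *\<^sub>C z"
    have "cinner (f ?s) t = 0"
      using p0 by (simp add: linear_simps [OF bl] sc cinner_diff_left cinner_scaleC_left
          flip: p_def)
    then have "cinner z ?s = 0"
      using z(2) by simp
    then have "cinner ?s z = 0"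
      by (subst cinner_commute) simp
    then have "cinner x z = cinner (f x) t / p * n"
      by (simp add: cinner_diff_left cinner_scaleC_left n_def)
    then show ?thesis
      using p0 n0 by (simp add: cinner_scaleC_right)
  qed
  then show ?thesis
    by blast
qed

lemma cadjoint:
  fixes f :: "'a::chilbert_space \<Rightarrow> 'b::complex_inner"
  assumes "bounded_clinear f"
  shows "cinner (f x) t = cinner x (cadjoint f t)"
proof -
  have "\<exists>!y. \<forall>x. cinner (f x) t = cinner x y"
    using cadjoint_exists [OF assms] by (metis cinner_right_eqI)
  from theI' [OF this] show ?thesis
    unfolding cadjoint_def by blast
qed

lemma subspace_closure_span:
  "cvs.subspace (closure (cvs.span E) :: 'a::complex_inner set)"
proof (rule cvs.subspaceI)
  show "0 \<in> closure (cvs.span E)"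
    using closure_subset cvs.span_zero by blast
next
  fix x y assume "x \<in> closure (cvs.span E)" "y \<in> closure (cvs.span E)"
  then obtain f g where "\<And>n. f n \<in> cvs.span E" "f \<longlonglongrightarrow> x" "\<And>n. g n \<in> cvs.span E" "g \<longlonglongrightarrow> y"
    by (auto simp: closure_sequential)
  then show "x + y \<in> closure (cvs.span E)"
    unfolding closure_sequential
    by (intro exI [of _ "\<lambda>n. f n + g n"]) (auto intro: tendsto_add cvs.span_add)
next
  fix c x assume "x \<in> closure (cvs.span E)"
  then obtain f where "\<And>n. f n \<in> cvs.span E" "f \<longlonglongrightarrow> x"
    by (auto simp: closure_sequential)
  then show "c *\<^sub>C x \<in> closure (cvs.span E)"
    unfolding closure_sequential
    by (intro exI [of _ "\<lambda>n. c *\<^sub>C f n"])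
      (auto intro: bounded_linear.tendsto [OF bounded_linear_scaleC] cvs.span_scale)
qed

lemma onb_exists: "\<exists>E :: 'a::chilbert_space set. is_onb E"
proof -
  define P where "P = (\<lambda>E :: 'a set. \<forall>e\<in>E. \<forall>f\<in>E. cinner e f = (if e = f then 1 else 0))"
  have "\<exists>M\<in>Collect P. \<forall>X\<in>Collect P. M \<subseteq> X \<longrightarrow> X = M"
  proof (rule subset_Zorn)
    fix C assume C: "subset.chain (Collect P) C"
    have "P (\<Union>C)"
      unfolding P_def
    proof (intro ballI)
      fix e f assume "e \<in> \<Union>C" "f \<in> \<Union>C"
      then obtain A B where "A \<in> C" "B \<in> C" "e \<in> A" "f \<in> B"
        by auto
      moreover from this have "A \<subseteq> B \<or> B \<subseteq> A"
        using C by (meson subset.chain_def subset_chain_def)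
      ultimately obtain D where "D \<in> C" "e \<in> D" "f \<in> D"
        by blast
      moreover from this have "P D"
        using C by (auto simp: subset_chain_def)
      ultimately show "cinner e f = (if e = f then 1 else 0)"
        unfolding P_def by blast
    qed
    then show "\<exists>U\<in>Collect P. \<forall>X\<in>C. X \<subseteq> U"
      by (intro bexI [of _ "\<Union>C"]) auto
  qed
  then obtain M where M: "P M" and max: "\<And>X. P X \<Longrightarrow> M \<subseteq> X \<Longrightarrow> X = M"
    by auto
  have "closure (cvs.span M) = UNIV"
  proof (rule ccontr)
    assume "closure (cvs.span M) \<noteq> UNIV"
    then obtain x where "x \<notin> closure (cvs.span M)"
      by auto
    then obtain z where z: "z \<noteq> 0" "\<And>s. s \<in> closure (cvs.span M) \<Longrightarrow> cinner z s = 0"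
      using closed_subspace_complement [OF closed_closure subspace_closure_span] by blast
    have zM: "cinner z m = 0" if "m \<in> M" for m
      using that z(2) closure_subset cvs.span_base by blast
    define u where "u = complex_of_real (1 / norm z) *\<^sub>C z"
    have u: "norm u = 1"
      using z(1) unfolding u_def norm_scaleC by (simp add: norm_divide)
    have uu: "cinner u u = 1"
      using u by (simp add: cinner_norm)
    have uM: "cinner u m = 0" if "m \<in> M" for m
      using zM [OF that] by (simp add: u_def cinner_scaleC_left)
    have Mu: "cinner m u = 0" if "m \<in> M" for m
      using uM [OF that] by (subst cinner_commute) simp
    have "u \<notin> M"
      using uu uM by force
    then have "P (insert u M)"
      using M uu uM Mu unfolding P_def by auto
    then have "insert u M = M"
      by (rule max) auto
    with \<open>u \<notin> M\<close> show False
      by auto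
  qed
  with M show ?thesis
    unfolding P_def is_onb_def by blast
qed

text \<open>The sums below do not depend on which orthonormal basis is chosen.\<close>

definition onb :: "'a::chilbert_space set" where
  "onb = (SOME E. is_onb E)"

lemma is_onb_onb: "is_onb onb"
  unfolding onb_def using onb_exists by (rule someI_ex)

definition compact_op :: "('a::complex_inner \<Rightarrow> 'b::complex_inner) \<Rightarrow> bool" where
  "compact_op T \<longleftrightarrow> bounded_clinear T \<and> compact (closure (T ` cball 0 1))"

definition hilbert_schmidt :: "('k::chilbert_space \<Rightarrow> 'k) \<Rightarrow> bool" where
  "hilbert_schmidt T \<longleftrightarrow> compact_op T \<and> (\<lambda>e. (norm (T e))\<^sup>2) summable_on onb"

lemma bounded_clinear_zero: "bounded_clinear (\<lambda>x. 0)"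
  by (simp add: bounded_clinear_def)

lemma bounded_clinear_add:
  "bounded_clinear f \<Longrightarrow> bounded_clinear g \<Longrightarrow> bounded_clinear (\<lambda>x. f x + g x)"
  by (simp add: bounded_clinear_def bounded_linear_add scaleC_add_right)

lemma bounded_clinear_scaleC:
  "bounded_clinear f \<Longrightarrow> bounded_clinear (\<lambda>x. c *\<^sub>C f x)"
  by (auto simp: bounded_clinear_def scaleC_scaleC mult.commute
      intro: bounded_linear_compose [OF bounded_linear_scaleC])

lemma compact_closure_subset_compact:
  fixes A :: "'a::complex_inner set"
  assumes "compact K" "A \<subseteq> K"
  shows "compact (closure A)"
proof -
  have "closure A \<subseteq> K"
    using assms by (simp add: closure_minimal compact_imp_closed)
  then have "K \<inter> closure A = closure A"
    by blast
  then show ?thesis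
    using compact_Int_closed [OF assms(1) closed_closure, of A] by simp
qed

lemma compact_op_add:
  assumes "compact_op S" "compact_op T"
  shows "compact_op (\<lambda>x. S x + T x)"
proof -
  let ?K = "{x + y |x y. x \<in> closure (S ` cball 0 1) \<and> y \<in> closure (T ` cball 0 1)}"
  have K: "compact ?K"
    using assms unfolding compact_op_def by (intro compact_sums) auto
  have "(\<lambda>x. S x + T x) ` cball 0 1 \<subseteq> ?K"
    using closure_subset by blast
  with K have "compact (closure ((\<lambda>x. S x + T x) ` cball 0 1))"
    by (rule compact_closure_subset_compact)
  with assms show ?thesis
    by (simp add: compact_op_def bounded_clinear_add)
qed

lemma compact_op_scaleC:
  assumes "compact_op T"
  shows "compact_op (\<lambda>x. c *\<^sub>C T x)"
proof -
  let ?K = "(*\<^sub>C) c ` closure (T ` cball 0 1)"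
  have K: "compact ?K"
    using assms unfolding compact_op_def
    by (intro compact_continuous_image linear_continuous_on bounded_linear_scaleC) auto
  have "(\<lambda>x. c *\<^sub>C T x) ` cball 0 1 \<subseteq> ?K"
    using closure_subset by blast
  with K have "compact (closure ((\<lambda>x. c *\<^sub>C T x) ` cball 0 1))"
    by (rule compact_closure_subset_compact)
  with assms show ?thesis
    by (simp add: compact_op_def bounded_clinear_scaleC)
qed

lemma compact_op_zero: "compact_op (\<lambda>x. 0)"
  by (auto simp: compact_op_def bounded_clinear_zero image_constant_conv)

lemma sq_sum_le:
  fixes f :: "'e \<Rightarrow> 'b::complex_inner"
  assumes f: "(\<lambda>e. (norm (f e))\<^sup>2) summable_on E" and F: "finite F" "F \<subseteq> E"
  shows "L2_set (\<lambda>e. norm (f e)) F \<le> sqrt (\<Sum>\<^sub>\<infinity>e\<in>E. (norm (f e))\<^sup>2)"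
  unfolding L2_set_def using f F by (intro real_sqrt_le_mono finite_sum_le_infsum) auto

lemma sq_summable_add:
  fixes f g :: "'e \<Rightarrow> 'b::complex_inner"
  assumes f: "(\<lambda>e. (norm (f e))\<^sup>2) summable_on E" and g: "(\<lambda>e. (norm (g e))\<^sup>2) summable_on E"
  shows "(\<lambda>e. (norm (f e + g e))\<^sup>2) summable_on E" (is ?A)
    and "sqrt (\<Sum>\<^sub>\<infinity>e\<in>E. (norm (f e + g e))\<^sup>2)
       \<le> sqrt (\<Sum>\<^sub>\<infinity>e\<in>E. (norm (f e))\<^sup>2) + sqrt (\<Sum>\<^sub>\<infinity>e\<in>E. (norm (g e))\<^sup>2)" (is ?B)
proof -
  let ?a = "sqrt (\<Sum>\<^sub>\<infinity>e\<in>E. (norm (f e))\<^sup>2)" and ?b = "sqrt (\<Sum>\<^sub>\<infinity>e\<in>E. (norm (g e))\<^sup>2)"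
  have bound: "(\<Sum>e\<in>F. (norm (f e + g e))\<^sup>2) \<le> (?a + ?b)\<^sup>2" if F: "finite F" "F \<subseteq> E" for F
  proof -
    have "L2_set (\<lambda>e. norm (f e + g e)) F \<le> L2_set (\<lambda>e. norm (f e) + norm (g e)) F"
      by (intro L2_set_mono) (auto intro: norm_triangle_ineq)
    also have "\<dots> \<le> L2_set (\<lambda>e. norm (f e)) F + L2_set (\<lambda>e. norm (g e)) F"
      by (rule L2_set_triangle_ineq)
    also have "\<dots> \<le> ?a + ?b"
      using sq_sum_le [OF f F] sq_sum_le [OF g F] by simp
    finally have "(L2_set (\<lambda>e. norm (f e + g e)) F)\<^sup>2 \<le> (?a + ?b)\<^sup>2"
      by (intro power_mono) auto
    then show ?thesis
      by (simp add: L2_set_def sum_nonneg)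
  qed
  show A: ?A
    by (rule nonneg_bdd_above_summable_on) (auto intro!: bdd_aboveI2 bound)
  have "(\<Sum>\<^sub>\<infinity>e\<in>E. (norm (f e + g e))\<^sup>2) \<le> (?a + ?b)\<^sup>2"
    using A bound by (rule infsum_le_finite_sums)
  then have "sqrt (\<Sum>\<^sub>\<infinity>e\<in>E. (norm (f e + g e))\<^sup>2) \<le> sqrt ((?a + ?b)\<^sup>2)"
    by (rule real_sqrt_le_mono)
  also have "\<dots> = ?a + ?b"
    by (simp add: infsum_nonneg)
  finally show ?B .
qed

lemma cinner_summable:
  fixes f g :: "'e \<Rightarrow> 'b::complex_inner"
  assumes f: "(\<lambda>e. (norm (f e))\<^sup>2) summable_on E" and g: "(\<lambda>e. (norm (g e))\<^sup>2) summable_on E"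
  shows "(\<lambda>e. cinner (f e) (g e)) summable_on E"
proof (rule abs_summable_summable)
  have "(\<lambda>e. (norm (f e))\<^sup>2 + (norm (g e))\<^sup>2) summable_on E"
    using f g by (rule summable_on_add)
  then show "(\<lambda>e. norm (cinner (f e) (g e))) summable_on E"
  proof (rule summable_on_comparison_test)
    fix e
    have "norm (cinner (f e) (g e)) \<le> norm (f e) * norm (g e)"
      by (rule cinner_Cauchy_Schwarz)
    also have "\<dots> \<le> (norm (f e))\<^sup>2 + (norm (g e))\<^sup>2"
      using sum_squares_bound [of "norm (f e)" "norm (g e)"]
        mult_nonneg_nonneg [OF norm_ge_zero norm_ge_zero, of "f e" "g e"] by linarith
    finally show "norm (cinner (f e) (g e)) \<le> (norm (f e))\<^sup>2 + (norm (g e))\<^sup>2" .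
  qed auto
qed

lemma hilbert_schmidt_zero: "hilbert_schmidt (\<lambda>x. 0)"
  by (simp add: hilbert_schmidt_def compact_op_zero)

lemma hilbert_schmidt_add:
  "hilbert_schmidt S \<Longrightarrow> hilbert_schmidt T \<Longrightarrow> hilbert_schmidt (\<lambda>x. S x + T x)"
  by (simp add: hilbert_schmidt_def compact_op_add sq_summable_add)

lemma hilbert_schmidt_scaleC:
  "hilbert_schmidt T \<Longrightarrow> hilbert_schmidt (\<lambda>x. c *\<^sub>C T x)"
  by (simp add: hilbert_schmidt_def compact_op_scaleC norm_scaleC power_mult_distrib
      summable_on_cmult_right)

lemma bounded_clinear_eq_zero_onb:
  fixes T :: "'a::chilbert_space \<Rightarrow> 'b::complex_inner"
  assumes T: "bounded_clinear T" and 0: "\<And>e. e \<in> onb \<Longrightarrow> T e = 0"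
  shows "T x = 0"
proof -
  have bl: "bounded_linear T" and sc: "\<And>c x. T (c *\<^sub>C x) = c *\<^sub>C T x"
    using T by (auto simp: bounded_clinear_def)
  have sub: "cvs.subspace {x. T x = 0}"
    using bl sc by (auto simp: cvs.subspace_def linear_simps)
  have cl: "closed {x. T x = 0}"
    using linear_continuous_on [OF bl, of UNIV]
    by (intro closed_Collect_eq) (auto intro: continuous_intros)
  have "cvs.span onb \<subseteq> {x. T x = 0}"
    using 0 by (intro cvs.span_minimal sub) auto
  then have "closure (cvs.span onb) \<subseteq> {x. T x = 0}"
    using cl by (rule closure_minimal)
  then show ?thesis
    using is_onb_onb by (auto simp: is_onb_def)
qed

typedef (overloaded) 'k hs = "{T :: 'k::chilbert_space \<Rightarrow> 'k. hilbert_schmidt T}"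
  morphisms hs_apply Abs_hs
  using hilbert_schmidt_zero by blast

setup_lifting type_definition_hs

instantiation hs :: (chilbert_space) complex_vector
begin

lift_definition zero_hs :: "'a hs" is "\<lambda>x. 0"
  by (rule hilbert_schmidt_zero)

lift_definition scaleC_hs :: "complex \<Rightarrow> 'a hs \<Rightarrow> 'a hs" is "\<lambda>c T x. c *\<^sub>C T x"
  by (rule hilbert_schmidt_scaleC)

lift_definition scaleR_hs :: "real \<Rightarrow> 'a hs \<Rightarrow> 'a hs" is "\<lambda>r T x. r *\<^sub>R T x"
  unfolding scaleC_of_real [symmetric] by (rule hilbert_schmidt_scaleC)

lift_definition plus_hs :: "'a hs \<Rightarrow> 'a hs \<Rightarrow> 'a hs" is "\<lambda>S T x. S x + T x"
  by (rule hilbert_schmidt_add)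

lift_definition uminus_hs :: "'a hs \<Rightarrow> 'a hs" is "\<lambda>T x. - T x"
  using hilbert_schmidt_scaleC [of _ "complex_of_real (-1)"] unfolding scaleC_of_real by simp

definition minus_hs :: "'a hs \<Rightarrow> 'a hs \<Rightarrow> 'a hs" where
  "minus_hs S T = S + (- T)"

instance
  by standard (unfold minus_hs_def, (transfer, simp add: algebra_simps scaleC_add_right
      scaleC_add_left scaleC_scaleC scaleC_of_real)+)

end

instantiation hs :: (chilbert_space) complex_inner
begin

lift_definition cinner_hs :: "'a hs \<Rightarrow> 'a hs \<Rightarrow> complex" is
  "\<lambda>T S. \<Sum>\<^sub>\<infinity>e\<in>onb. cinner (T e) (S e)" .

lift_definition norm_hs :: "'a hs \<Rightarrow> real" is
  "\<lambda>T. sqrt (\<Sum>\<^sub>\<infinity>e\<in>onb. (norm (T e))\<^sup>2)" .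

definition dist_hs :: "'a hs \<Rightarrow> 'a hs \<Rightarrow> real" where
  "dist_hs S T = norm (S - T)"

definition sgn_hs :: "'a hs \<Rightarrow> 'a hs" where
  "sgn_hs T = inverse (norm T) *\<^sub>R T"

definition uniformity_hs :: "('a hs \<times> 'a hs) filter" where
  "uniformity_hs = (INF e\<in>{0 <..}. principal {(S, T). dist S T < e})"

definition open_hs :: "'a hs set \<Rightarrow> bool" where
  "open_hs U = (\<forall>S\<in>U. \<forall>\<^sub>F (S', T) in uniformity. S' = S \<longrightarrow> T \<in> U)"

instance
proof
  fix S T U :: "'a hs" and c :: complex and r :: real
  show "dist S T = norm (S - T)"
    by (rule dist_hs_def)
  show "sgn T = inverse (norm T) *\<^sub>R T"
    by (rule sgn_hs_def)
  show "norm (S + T) \<le> norm S + norm T"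
    by transfer (auto simp: hilbert_schmidt_def intro: sq_summable_add)
  show "norm (r *\<^sub>R T) = \<bar>r\<bar> * norm T"
    by transfer (simp add: power_mult_distrib infsum_cmult_right' real_sqrt_mult)
  show "norm T = 0 \<longleftrightarrow> T = 0"
  proof transfer
    fix T :: "'a \<Rightarrow> 'a" assume T: "hilbert_schmidt T"
    show "sqrt (\<Sum>\<^sub>\<infinity>e\<in>onb. (norm (T e))\<^sup>2) = 0 \<longleftrightarrow> T = (\<lambda>x. 0)"
    proof
      assume "sqrt (\<Sum>\<^sub>\<infinity>e\<in>onb. (norm (T e))\<^sup>2) = 0"
      then have 0: "(norm (T e))\<^sup>2 = 0" if "e \<in> onb" for e
        using T that by (intro nonneg_infsum_le_0D [where A = onb]) (auto simp: hilbert_schmidt_def)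
      have "T x = 0" for x
        by (rule bounded_clinear_eq_zero_onb)
          (use T 0 in \<open>auto simp: hilbert_schmidt_def compact_op_def\<close>)
      then show "T = (\<lambda>x. 0)"
        by blast
    qed simp
  qed
  show "cinner S T = cnj (cinner T S)"
    by transfer (metis (no_types, lifting) cinner_commute infsum_cnj infsum_cong)
  show "cinner (S + T) U = cinner S U + cinner T U"
    by transfer (simp add: hilbert_schmidt_def cinner_add_left infsum_add cinner_summable)
  show "cinner (c *\<^sub>C S) T = c * cinner S T"
    by transfer (simp add: cinner_scaleC_left infsum_cmult_right')
  show "cinner T T = complex_of_real ((norm T)\<^sup>2)"
  proof transfer
    fix T :: "'a \<Rightarrow> 'a" assume "hilbert_schmidt T"
    then have "((\<lambda>e. (norm (T e))\<^sup>2) has_sum (\<Sum>\<^sub>\<infinity>e\<in>onb. (norm (T e))\<^sup>2)) onb"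
      unfolding hilbert_schmidt_def by (intro has_sum_infsum) simp
    then have "(\<Sum>\<^sub>\<infinity>e\<in>onb. complex_of_real ((norm (T e))\<^sup>2))
        = complex_of_real (\<Sum>\<^sub>\<infinity>e\<in>onb. (norm (T e))\<^sup>2)"
      by (intro infsumI has_sum_bounded_linear [OF bounded_linear_of_real, unfolded o_def])
    then show "(\<Sum>\<^sub>\<infinity>e\<in>onb. cinner (T e) (T e))
        = complex_of_real ((sqrt (\<Sum>\<^sub>\<infinity>e\<in>onb. (norm (T e))\<^sup>2))\<^sup>2)"
      by (simp add: cinner_norm infsum_nonneg del: of_real_power)
  qed
qed (simp_all only: uniformity_hs_def open_hs_def)

end

definition hs_frame ::
  "'i set \<Rightarrow> ('i \<Rightarrow> 'h::complex_inner \<Rightarrow> 'k::chilbert_space hs) \<Rightarrow> real \<Rightarrow> real \<Rightarrow> bool" where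
  "hs_frame I G A B \<longleftrightarrow>
     (\<forall>i\<in>I. bounded_clinear (G i)) \<and> 0 < A \<and> 0 < B \<and>
     (\<forall>x. (\<lambda>i. (norm (G i x))\<^sup>2) summable_on I \<and>
          A * (norm x)\<^sup>2 \<le> (\<Sum>\<^sub>\<infinity>i\<in>I. (norm (G i x))\<^sup>2) \<and>
          (\<Sum>\<^sub>\<infinity>i\<in>I. (norm (G i x))\<^sup>2) \<le> B * (norm x)\<^sup>2)"

end

theory Submission
  imports Defs
begin

text \<open>
  Why the theorem holds. By Young's inequality
  \<open>x\<^sup>\<alpha> y\<^sup>\<beta> \<le> \<alpha> x + \<beta> y\<close> the hypothesis implies, for all finite sums
  \<open>u = \<Sum> G\<^sub>i\<^sup>* T\<^sub>i\<close> and \<open>v = \<Sum> H\<^sub>i\<^sup>* T\<^sub>i\<close> formed with the same \<open>T\<^sub>i\<close>, the linear estimate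
  \<open>\<parallel>u - v\<parallel> \<le> p \<parallel>u\<parallel> + q \<parallel>v\<parallel>\<close> with \<open>p = \<alpha> \<lambda>\<^sub>1 + \<beta> \<lambda>\<^sub>2 < 1\<close> and
  \<open>q = \<beta> \<lambda>\<^sub>1 + \<alpha> \<lambda>\<^sub>2 < 1\<close>. In particular \<open>v\<close> is bounded by a multiple of \<open>u\<close>, so \<open>u \<mapsto> v\<close> is a
  well-defined bounded map. The vectors \<open>u\<close> are dense, because a vector orthogonal to all of
  them is annihilated by every \<open>G\<^sub>i\<close>, and hence zero by the lower frame bound. So the map
  extends to a bounded operator \<open>L\<close> on the whole space (\<open>bounded_clinear_of_dense_relation\<close>) that
  inherits the estimate \<open>\<parallel>u - L u\<parallel> \<le> p \<parallel>u\<parallel> + q \<parallel>L u\<parallel>\<close>.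

  By construction \<open>L G\<^sub>i\<^sup>* = H\<^sub>i\<^sup>*\<close>, that is \<open>H\<^sub>i = G\<^sub>i L\<^sup>*\<close>. The frame inequality for \<open>H\<close> at \<open>x\<close> is
  therefore the one for \<open>G\<close> at \<open>L\<^sup>* x\<close>, and it only remains to compare \<open>\<parallel>L\<^sup>* x\<parallel>\<close> with \<open>\<parallel>x\<parallel>\<close>
  (\<open>norm_cadjoint_near_identity\<close>). The estimate for \<open>L\<close> gives
  \<open>(1 - p) \<parallel>u\<parallel> \<le> (1 + q) \<parallel>L u\<parallel>\<close> and \<open>(1 - q) \<parallel>L u\<parallel> \<le> (1 + p) \<parallel>u\<parallel>\<close> at once. The upper bound
  passes to \<open>L\<^sup>*\<close>; the lower bound does so only if \<open>L\<close> has dense range. This is shown by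
  moving from the identity to \<open>L\<close> along the segment \<open>1 + s (L - 1)\<close> in small steps, each of which
  preserves density of the range (\<open>dense_range_near_identity\<close>).
\<close>

section \<open>Adjoints and dense subspaces\<close>

lemma bounded_clinearD:
  assumes "bounded_clinear f"
  shows "bounded_linear f" and "f (c *\<^sub>C x) = c *\<^sub>C f x"
    and "f (x + y) = f x + f y" and "f (x - y) = f x - f y" and "f 0 = 0"
  using assms by (auto simp: bounded_clinear_def linear_simps)

lemma cinner_left_eqI:
  assumes "\<And>y. cinner x y = cinner (x' :: 'a::complex_inner) y"
  shows "x = x'"
  by (rule cinner_right_eqI) (metis assms cinner_commute)

lemma cmod_cinner_self: "cmod (cinner x x) = (norm (x :: 'a::complex_inner))\<^sup>2"
  unfolding cinner_norm norm_of_real by simp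

lemma cadjoint_swap:
  fixes f :: "'a::chilbert_space \<Rightarrow> 'b::complex_inner"
  assumes "bounded_clinear f"
  shows "cinner (cadjoint f t) x = cinner t (f x)"
  using cadjoint [OF assms, of x t] by (metis cinner_commute)

lemma cadjoint_add:
  fixes f :: "'a::chilbert_space \<Rightarrow> 'b::complex_inner"
  assumes "bounded_clinear f"
  shows "cadjoint f (s + t) = cadjoint f s + cadjoint f t"
  by (rule cinner_left_eqI) (simp add: cadjoint_swap [OF assms] cinner_add_left)

lemma cadjoint_scaleC:
  fixes f :: "'a::chilbert_space \<Rightarrow> 'b::complex_inner"
  assumes "bounded_clinear f"
  shows "cadjoint f (c *\<^sub>C t) = c *\<^sub>C cadjoint f t"
  by (rule cinner_left_eqI) (simp add: cadjoint_swap [OF assms] cinner_scaleC_left)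

lemma cadjoint_zero:
  fixes f :: "'a::chilbert_space \<Rightarrow> 'b::complex_inner"
  assumes "bounded_clinear f"
  shows "cadjoint f 0 = 0"
  by (rule cinner_left_eqI) (simp add: cadjoint_swap [OF assms])

lemma subspace_range:
  assumes "bounded_clinear f"
  shows "cvs.subspace (range f)"
  using bounded_clinearD [OF assms]
  by (intro cvs.subspaceI) (auto simp: image_iff, metis+)

text \<open>Hilbert space form of density: no nonzero vector is orthogonal to the subspace.\<close>

lemma dense_subspaceI:
  fixes S :: "'h::chilbert_space set"
  assumes sub: "cvs.subspace S"
    and orth: "\<And>z. (\<And>s. s \<in> S \<Longrightarrow> cinner z s = 0) \<Longrightarrow> z = 0"
  shows "closure S = UNIV"
proof (rule ccontr)
  assume "closure S \<noteq> UNIV"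
  then obtain x where x: "x \<notin> closure S" by auto
  have "cvs.subspace (closure S)"
    using subspace_closure_span [of S] unfolding cvs.span_eq_iff [THEN iffD2, OF sub] .
  from closed_subspace_complement [OF closed_closure this x]
  obtain z where "z \<noteq> 0" "\<And>s. s \<in> closure S \<Longrightarrow> cinner z s = 0" by blast
  with orth closure_subset show False by blast
qed

section \<open>Operators close to the identity\<close>

text \<open>
  A unit vector \<open>z\<close> orthogonal to the range of \<open>W'\<close> has distance at least \<open>1\<close> from it. But \<open>z\<close> is
  approximated by vectors \<open>W x\<close>, and \<open>W' x\<close> is within about \<open>m < 1\<close> of those. The
  perturbation is measured against \<open>W x\<close>, not \<open>x\<close>, because the \<open>W x\<close> converge to \<open>z\<close> while
  the \<open>x\<close> may be unbounded.
\<close>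

lemma dense_range_perturbation:
  fixes W W' :: "'a::complex_inner \<Rightarrow> 'h::chilbert_space"
  assumes W': "bounded_clinear W'"
    and dense: "closure (range W) = UNIV"
    and close: "\<And>x. norm (W' x - W x) \<le> m * norm (W x)" and m: "m < 1"
  shows "closure (range W') = UNIV"
proof (rule dense_subspaceI)
  show "cvs.subspace (range W')"
    by (rule subspace_range [OF W'])
next
  fix z assume orth: "\<And>s. s \<in> range W' \<Longrightarrow> cinner z s = 0"
  have "z \<in> closure (range W)"
    using dense by simp
  then obtain w where w: "\<And>n. w n \<in> range W" "w \<longlonglongrightarrow> z"
    by (auto simp: closure_sequential)
  have le: "cmod (cinner z (w n)) \<le> norm z * (m * norm (w n))" for n
  proof -
    obtain x where x: "w n = W x" using w(1) by blast
    have "cmod (cinner z (w n)) = cmod (cinner z (W' x - W x))"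
      by (simp add: x cinner_diff_right orth)
    also have "\<dots> \<le> norm z * norm (W' x - W x)"
      by (rule cinner_Cauchy_Schwarz)
    also have "\<dots> \<le> norm z * (m * norm (w n))"
      unfolding x by (intro mult_left_mono close) simp
    finally show ?thesis .
  qed
  have "cmod (cinner z z) \<le> norm z * (m * norm z)"
  proof (rule LIMSEQ_le)
    show "(\<lambda>n. cmod (cinner z (w n))) \<longlonglongrightarrow> cmod (cinner z z)"
      by (intro tendsto_norm bounded_linear.tendsto [OF bounded_linear_cinner_right] w(2))
    show "(\<lambda>n. norm z * (m * norm (w n))) \<longlonglongrightarrow> norm z * (m * norm z)"
      by (intro tendsto_intros w(2))
  qed (use le in blast)
  then have "(1 - m) * (norm z)\<^sup>2 \<le> 0"
    by (simp add: cmod_cinner_self power2_eq_square algebra_simps)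
  then show "z = 0"
    using m by (simp add: mult_le_0_iff)
qed

text \<open>
  Being bounded below does not suffice for dense range (think of a shift), so a path from \<open>L\<close> to
  the identity enters: with \<open>W s = 1 + s (L - 1)\<close>, the estimate makes \<open>\<parallel>L x - x\<parallel> \<le> M \<parallel>W s x\<parallel>\<close> with
  the same \<open>M\<close> for all \<open>s\<close> in \<open>[0, 1]\<close>. A step of length \<open>1 / n\<close> with \<open>n > M\<close> is thus a small
  relative perturbation, and \<open>n\<close> such steps lead from the identity to \<open>L\<close>.
\<close>

lemma dense_range_near_identity:
  fixes L :: "'h::chilbert_space \<Rightarrow> 'h"
  assumes L: "bounded_clinear L"
    and near: "\<And>x. norm (x - L x) \<le> p * norm x + q * norm (L x)"
    and "p < 1" "q < 1"
  shows "closure (range L) = UNIV"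
proof -
  define W where "W = (\<lambda>s::real. \<lambda>x. complex_of_real (1 - s) *\<^sub>C x + complex_of_real s *\<^sub>C L x)"
  define m where "m = max 0 (max p q)"
  define M where "M = 2 * m / (1 - m)"
  have m: "0 \<le> m" "m < 1" "p \<le> m" "q \<le> m"
    using assms by (auto simp: m_def)
  have W: "bounded_clinear (W s)" for s
    unfolding W_def
    by (intro bounded_clinear_add bounded_clinear_scaleC L) (simp add: bounded_clinear_def)
  have WR: "W s x = x + s *\<^sub>R (L x - x)" for s x
    unfolding W_def scaleC_of_real by (simp add: algebra_simps)
  \<comment> \<open>Express \<open>x\<close> and \<open>L x\<close> by \<open>W s x\<close> and \<open>d = L x - x\<close>: together they contain exactly one
    copy of \<open>d\<close>, which the factor \<open>m < 1\<close> allows to absorb.\<close>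
  have drift: "norm (L x - x) \<le> M * norm (W s x)" if s: "0 \<le> s" "s \<le> 1" for s x
  proof -
    define d where "d = L x - x"
    have "x = W s x - s *\<^sub>R d" "L x = W s x + (1 - s) *\<^sub>R d"
      by (simp_all add: WR d_def algebra_simps)
    then have "norm x \<le> norm (W s x) + s * norm d" "norm (L x) \<le> norm (W s x) + (1 - s) * norm d"
      using s norm_triangle_ineq4 [of "W s x" "s *\<^sub>R d"]
        norm_triangle_ineq [of "W s x" "(1 - s) *\<^sub>R d"] by simp_all
    then have sum: "norm x + norm (L x) \<le> 2 * norm (W s x) + norm d"
      by (simp add: algebra_simps)
    have "norm d \<le> p * norm x + q * norm (L x)"
      using near [of x] by (simp add: d_def norm_minus_commute)
    also have "\<dots> \<le> m * norm x + m * norm (L x)"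
      using m by (intro add_mono mult_right_mono) auto
    also have "\<dots> \<le> m * (2 * norm (W s x) + norm d)"
      using mult_left_mono [OF sum m(1)] by (simp add: distrib_left)
    finally have "(1 - m) * norm d \<le> 2 * m * norm (W s x)"
      by (simp add: algebra_simps)
    then show ?thesis
      using m by (simp add: M_def d_def field_simps)
  qed
  obtain n :: nat where n: "M < real n" "0 < n"
    using reals_Archimedean2 [of "max M 0"] by auto
  have "k \<le> n \<Longrightarrow> closure (range (W (real k / real n))) = UNIV" for k
  proof (induction k)
    case 0
    then show ?case by (simp add: WR)
  next
    case (Suc k)
    let ?s = "real k / real n"
    have s: "0 \<le> ?s" "?s \<le> 1"
      using Suc.prems by auto
    show ?case
    proof (rule dense_range_perturbation)
      show "closure (range (W ?s)) = UNIV"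
        using Suc by simp
      show "norm (W (real (Suc k) / real n) x - W ?s x) \<le> M / real n * norm (W ?s x)" for x
      proof -
        have "W (real (Suc k) / real n) x - W ?s x = (1 / real n) *\<^sub>R (L x - x)"
          by (simp add: WR add_divide_distrib scaleR_add_left)
        then show ?thesis
          using drift [OF s, of x] n by (simp add: divide_right_mono)
      qed
      show "M / real n < 1"
        using n by simp
    qed (rule W)
  qed
  from this [of n] show ?thesis
    using n by (simp add: WR)
qed

text \<open>
  For the lower bound, suppose that \<open>x = L u\<close>; then
  \<open>\<parallel>x\<parallel>\<^sup>2 = \<langle>u, L\<^sup>* x\<rangle> \<le> \<parallel>u\<parallel> \<parallel>L\<^sup>* x\<parallel> \<le> (1 + q) / (1 - p) \<parallel>x\<parallel> \<parallel>L\<^sup>* x\<parallel>\<close>. For general \<open>x\<close> this holds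
  in the limit, as the range of \<open>L\<close> is dense.
\<close>

lemma norm_cadjoint_near_identity:
  fixes L :: "'h::chilbert_space \<Rightarrow> 'h"
  assumes L: "bounded_clinear L"
    and near: "\<And>x. norm (x - L x) \<le> p * norm x + q * norm (L x)"
    and p: "0 \<le> p" "p < 1" and q: "0 \<le> q" "q < 1"
  shows "(1 - p) / (1 + q) * norm x \<le> norm (cadjoint L x)"
    and "norm (cadjoint L x) \<le> (1 + p) / (1 - q) * norm x"
proof -
  have lower: "(1 - p) * norm u \<le> (1 + q) * norm (L u)" for u
    using near [of u] norm_triangle_ineq2 [of u "L u"] by (simp add: algebra_simps)
  have upper: "(1 - q) * norm (L u) \<le> (1 + p) * norm u" for u
    using near [of u] norm_triangle_ineq2 [of "L u" u]
    by (simp add: algebra_simps norm_minus_commute)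
  define y where "y = cadjoint L x"
  have adj: "cinner (L u) x = cinner u y" for u
    unfolding y_def by (rule cadjoint [OF L])
  have "(norm y)\<^sup>2 = cmod (cinner (L y) x)"
    unfolding adj by (rule cmod_cinner_self [symmetric])
  also have "\<dots> \<le> norm (L y) * norm x"
    by (rule cinner_Cauchy_Schwarz)
  also have "\<dots> \<le> (1 + p) / (1 - q) * norm y * norm x"
    using upper [of y] q by (intro mult_right_mono) (auto simp: field_simps)
  finally have "norm y * norm y \<le> norm y * ((1 + p) / (1 - q) * norm x)"
    by (simp add: power2_eq_square mult_ac)
  moreover have "0 \<le> (1 + p) / (1 - q) * norm x"
    using p q by simp
  ultimately show "norm (cadjoint L x) \<le> (1 + p) / (1 - q) * norm x"
    unfolding y_def [symmetric] by (metis mult_le_cancel_left_pos norm_ge_zero order_le_less)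
  have "x \<in> closure (range L)"
    using dense_range_near_identity [OF L near p(2) q(2)] by simp
  then obtain w where w: "\<And>n. w n \<in> range L" "w \<longlonglongrightarrow> x"
    by (auto simp: closure_sequential)
  have le: "(1 - p) * cmod (cinner (w n) x) \<le> (1 + q) * norm (w n) * norm y" for n
  proof -
    obtain u where u: "w n = L u" using w(1) by blast
    have "(1 - p) * cmod (cinner (w n) x) \<le> (1 - p) * (norm u * norm y)"
      unfolding u adj using p by (intro mult_left_mono cinner_Cauchy_Schwarz) auto
    also have "\<dots> \<le> (1 + q) * norm (w n) * norm y"
      using mult_right_mono [OF lower [of u] norm_ge_zero [of y]] by (simp add: u mult_ac)
    finally show ?thesis .
  qed
  have "(1 - p) * cmod (cinner x x) \<le> (1 + q) * norm x * norm y"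
  proof (rule LIMSEQ_le)
    show "(\<lambda>n. (1 - p) * cmod (cinner (w n) x)) \<longlonglongrightarrow> (1 - p) * cmod (cinner x x)"
      by (intro tendsto_intros bounded_linear.tendsto [OF bounded_linear_cinner_left] w(2))
    show "(\<lambda>n. (1 + q) * norm (w n) * norm y) \<longlonglongrightarrow> (1 + q) * norm x * norm y"
      by (intro tendsto_intros w(2))
  qed (use le in blast)
  then have "norm x * ((1 - p) * norm x) \<le> norm x * ((1 + q) * norm y)"
    by (simp add: cmod_cinner_self power2_eq_square mult_ac)
  then have "(1 - p) * norm x \<le> (1 + q) * norm y"
    using q by (cases "x = 0") auto
  then show "(1 - p) / (1 + q) * norm x \<le> norm (cadjoint L x)"
    using q by (simp add: y_def field_simps)
qed

section \<open>Extending a bounded linear relation to an operator\<close>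

text \<open>
  Extension by continuity, with a linear relation in place of a partial function: single-valuedness
  is a consequence of the bound, so nothing has to be checked about different representations of
  the same \<open>u\<close>. The graph of \<open>L\<close> is the closure of \<open>R\<close>; through this, every closed condition on
  \<open>R\<close> carries over to \<open>L\<close>.
\<close>

lemma bounded_clinear_of_dense_relation:
  fixes R :: "('h::chilbert_space \<times> 'h) set"
  assumes zero: "(0, 0) \<in> R"
    and add: "\<And>u v u' v'. (u, v) \<in> R \<Longrightarrow> (u', v') \<in> R \<Longrightarrow> (u + u', v + v') \<in> R"
    and scale: "\<And>c u v. (u, v) \<in> R \<Longrightarrow> (c *\<^sub>C u, c *\<^sub>C v) \<in> R"
    and bound: "\<And>u v. (u, v) \<in> R \<Longrightarrow> norm v \<le> C * norm u"
    and dense: "closure (fst ` R) = UNIV"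
  obtains L where "bounded_clinear L"
    and "\<And>u. (u, L u) \<in> closure R" and "\<And>u v. (u, v) \<in> R \<Longrightarrow> L u = v"
proof -
  have closureE: thesis
    if uv: "(u, v) \<in> closure R"
      and *: "\<And>f g. (\<And>n. (f n, g n) \<in> R) \<Longrightarrow> f \<longlonglongrightarrow> u \<Longrightarrow> g \<longlonglongrightarrow> v \<Longrightarrow> thesis" for u v thesis
  proof -
    obtain h where h: "\<forall>n. h n \<in> R" "h \<longlonglongrightarrow> (u, v)"
      using uv unfolding closure_sequential by blast
    show thesis
      using * [of "\<lambda>n. fst (h n)" "\<lambda>n. snd (h n)"] h tendsto_fst [OF h(2)] tendsto_snd [OF h(2)]
      by simp
  qed
  have closureI: "(u, v) \<in> closure R"
    if "\<And>n. (f n, g n) \<in> R" "f \<longlonglongrightarrow> u" "g \<longlonglongrightarrow> v" for u v f g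
    unfolding closure_sequential
    by (intro exI [of _ "\<lambda>n. (f n, g n)"] conjI allI tendsto_Pair that)
  have add': "(u + u', v + v') \<in> closure R"
    if uv: "(u, v) \<in> closure R" and uv': "(u', v') \<in> closure R" for u v u' v'
  proof (rule closureE [OF uv], rule closureE [OF uv'])
    fix f g f' g'
    assume fg: "\<And>n. (f n, g n) \<in> R" "f \<longlonglongrightarrow> u" "g \<longlonglongrightarrow> v"
      and fg': "\<And>n. (f' n, g' n) \<in> R" "f' \<longlonglongrightarrow> u'" "g' \<longlonglongrightarrow> v'"
    show ?thesis
      by (rule closureI [OF add [OF fg(1) fg'(1)] tendsto_add [OF fg(2) fg'(2)]
            tendsto_add [OF fg(3) fg'(3)]])
  qed
  have scale': "(c *\<^sub>C u, c *\<^sub>C v) \<in> closure R" if uv: "(u, v) \<in> closure R" for c u v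
  proof (rule closureE [OF uv])
    fix f g
    assume fg: "\<And>n. (f n, g n) \<in> R" "f \<longlonglongrightarrow> u" "g \<longlonglongrightarrow> v"
    show ?thesis
      by (rule closureI [OF scale [OF fg(1)]];
          rule bounded_linear.tendsto [OF bounded_linear_scaleC], rule fg)
  qed
  have bound': "norm v \<le> C * norm u" if uv: "(u, v) \<in> closure R" for u v
  proof -
    obtain f g where fg: "\<And>n. (f n, g n) \<in> R" "f \<longlonglongrightarrow> u" "g \<longlonglongrightarrow> v"
      using uv by (rule closureE) blast
    show ?thesis
    proof (rule LIMSEQ_le)
      show "(\<lambda>n. norm (g n)) \<longlonglongrightarrow> norm v" "(\<lambda>n. C * norm (f n)) \<longlonglongrightarrow> C * norm u"
        by (intro tendsto_intros fg)+
    qed (use bound fg(1) in blast)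
  qed
  have diff: "(u - u', v - v') \<in> R" if "(u, v) \<in> R" "(u', v') \<in> R" for u v u' v'
    using add [OF that(1) scale [OF that(2), of "complex_of_real (- 1)"]]
    unfolding scaleC_of_real by simp
  have diff': "(u - u', v - v') \<in> closure R"
    if uv: "(u, v) \<in> closure R" and uv': "(u', v') \<in> closure R" for u v u' v'
  proof (rule closureE [OF uv], rule closureE [OF uv'])
    fix f g f' g'
    assume fg: "\<And>n. (f n, g n) \<in> R" "f \<longlonglongrightarrow> u" "g \<longlonglongrightarrow> v"
      and fg': "\<And>n. (f' n, g' n) \<in> R" "f' \<longlonglongrightarrow> u'" "g' \<longlonglongrightarrow> v'"
    show ?thesis
      by (rule closureI [OF diff [OF fg(1) fg'(1)] tendsto_diff [OF fg(2) fg'(2)]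
            tendsto_diff [OF fg(3) fg'(3)]])
  qed
  have unique: "v = v'" if "(u, v) \<in> closure R" "(u, v') \<in> closure R" for u v v'
    using bound' [OF diff' [OF that]] by simp
  have total: "\<exists>v. (u, v) \<in> closure R" for u
  proof -
    have "u \<in> closure (fst ` R)"
      using dense by simp
    then obtain f where f: "\<And>n. f n \<in> fst ` R" "f \<longlonglongrightarrow> u"
      by (auto simp: closure_sequential)
    then have "\<forall>n. \<exists>v. (f n, v) \<in> R"
      by force
    then obtain g where g: "\<And>n. (f n, g n) \<in> R"
      by metis
    have "Cauchy g"
    proof (rule metric_CauchyI)
      fix e :: real assume e: "0 < e"
      have "Cauchy f"
        using f(2) by (rule LIMSEQ_imp_Cauchy)
      moreover have "0 < e / (\<bar>C\<bar> + 1)"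
        using e by simp
      ultimately obtain N where N: "\<And>m n. m \<ge> N \<Longrightarrow> n \<ge> N \<Longrightarrow> dist (f m) (f n) < e / (\<bar>C\<bar> + 1)"
        by (meson metric_CauchyD)
      have "dist (g m) (g n) < e" if "m \<ge> N" "n \<ge> N" for m n
      proof -
        have "dist (g m) (g n) \<le> C * dist (f m) (f n)"
          unfolding dist_norm by (rule bound [OF diff [OF g g]])
        also have "\<dots> \<le> (\<bar>C\<bar> + 1) * dist (f m) (f n)"
          by (intro mult_right_mono) auto
        also have "\<dots> < e"
          using N [OF that] by (simp add: field_simps)
        finally show ?thesis .
      qed
      then show "\<exists>M. \<forall>m\<ge>M. \<forall>n\<ge>M. dist (g m) (g n) < e"
        by blast
    qed
    then obtain v where "g \<longlonglongrightarrow> v"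
      using Cauchy_convergent convergent_def by blast
    then show ?thesis
      using closureI [OF g f(2)] by blast
  qed
  then obtain L where L: "\<And>u. (u, L u) \<in> closure R"
    by metis
  have sc: "L (c *\<^sub>C u) = c *\<^sub>C L u" for c u
    by (rule unique [OF L scale' [OF L]])
  have "bounded_linear L"
  proof (rule bounded_linear_intro)
    show "L (u + u') = L u + L u'" for u u'
      by (rule unique [OF L add' [OF L L]])
    show "L (r *\<^sub>R u) = r *\<^sub>R L u" for r u
      using sc [of "complex_of_real r" u] by (simp add: scaleC_of_real)
    show "norm (L u) \<le> norm u * C" for u
      using bound' [OF L, of u] by (simp add: mult.commute)
  qed
  then have "bounded_clinear L"
    by (simp add: bounded_clinear_def sc)
  moreover have "L u = v" if "(u, v) \<in> R" for u v
    using that closure_subset by (blast intro: unique [OF L])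
  ultimately show ?thesis
    using that L by blast
qed

section \<open>Perturbation of frames\<close>

lemma hs_frame_compose:
  assumes G: "hs_frame I G A B" and H: "\<And>i. i \<in> I \<Longrightarrow> bounded_clinear (H i)"
    and eq: "\<And>i x. i \<in> I \<Longrightarrow> H i x = G i (K x)"
    and lower: "\<And>x. a * norm x \<le> norm (K x)" and upper: "\<And>x. norm (K x) \<le> b * norm x"
    and a: "0 < a" and b: "0 < b"
  shows "hs_frame I H (A * a\<^sup>2) (B * b\<^sup>2)"
proof -
  have A: "0 < A" and B: "0 < B"
    and sm: "\<And>x. (\<lambda>i. (norm (G i x))\<^sup>2) summable_on I"
    and lo: "\<And>x. A * (norm x)\<^sup>2 \<le> (\<Sum>\<^sub>\<infinity>i\<in>I. (norm (G i x))\<^sup>2)"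
    and up: "\<And>x. (\<Sum>\<^sub>\<infinity>i\<in>I. (norm (G i x))\<^sup>2) \<le> B * (norm x)\<^sup>2"
    using G by (auto simp: hs_frame_def)
  have sum: "(\<Sum>\<^sub>\<infinity>i\<in>I. (norm (H i x))\<^sup>2) = (\<Sum>\<^sub>\<infinity>i\<in>I. (norm (G i (K x)))\<^sup>2)" for x
    by (rule infsum_cong) (simp add: eq)
  have summable: "(\<lambda>i. (norm (H i x))\<^sup>2) summable_on I" for x
    using sm [of "K x"] by (simp add: eq cong: summable_on_cong)
  have lo': "A * a\<^sup>2 * (norm x)\<^sup>2 \<le> (\<Sum>\<^sub>\<infinity>i\<in>I. (norm (G i (K x)))\<^sup>2)" for x
  proof -
    have "(a * norm x)\<^sup>2 \<le> (norm (K x))\<^sup>2"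
      using a by (intro power_mono lower) auto
    then have "A * (a * norm x)\<^sup>2 \<le> A * (norm (K x))\<^sup>2"
      using A by (intro mult_left_mono) auto
    from this lo [of "K x"] have "A * (a * norm x)\<^sup>2 \<le> (\<Sum>\<^sub>\<infinity>i\<in>I. (norm (G i (K x)))\<^sup>2)"
      by (rule order_trans)
    then show ?thesis
      by (simp only: power_mult_distrib mult.assoc)
  qed
  have up': "(\<Sum>\<^sub>\<infinity>i\<in>I. (norm (G i (K x)))\<^sup>2) \<le> B * b\<^sup>2 * (norm x)\<^sup>2" for x
  proof -
    have "(norm (K x))\<^sup>2 \<le> (b * norm x)\<^sup>2"
      by (intro power_mono upper) auto
    then have "B * (norm (K x))\<^sup>2 \<le> B * (b * norm x)\<^sup>2"
      using B by (intro mult_left_mono) auto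
    with up [of "K x"] have "(\<Sum>\<^sub>\<infinity>i\<in>I. (norm (G i (K x)))\<^sup>2) \<le> B * (b * norm x)\<^sup>2"
      by (rule order_trans)
    then show ?thesis
      by (simp only: power_mult_distrib mult.assoc)
  qed
  show ?thesis
    unfolding hs_frame_def sum
    by (intro conjI allI ballI H summable lo' up' mult_pos_pos zero_less_power A B a b)
qed

text \<open>
  The relation pairs the two finite sums that belong to the same coefficients \<open>T\<close>; it is the
  graph of the map from the synthesis of \<open>G\<close> to that of \<open>H\<close> whenever this map is well defined.
\<close>

definition synthesis_relation ::
  "'i set \<Rightarrow> ('i \<Rightarrow> 'h::complex_inner \<Rightarrow> 'k::complex_inner) \<Rightarrow> ('i \<Rightarrow> 'h \<Rightarrow> 'k) \<Rightarrow> ('h \<times> 'h) set"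
  where "synthesis_relation I G H =
    {(\<Sum>i\<in>J. cadjoint (G i) (T i), \<Sum>i\<in>J. cadjoint (H i) (T i)) |J T. finite J \<and> J \<subseteq> I}"

lemma synthesis_relation_zero: "(0, 0) \<in> synthesis_relation I G H"
  unfolding synthesis_relation_def by (intro CollectI exI [of _ "{}"]) auto

lemma synthesis_relation_add:
  fixes G H :: "'i \<Rightarrow> 'h::chilbert_space \<Rightarrow> 'k::complex_inner"
  assumes G: "\<And>i. i \<in> I \<Longrightarrow> bounded_clinear (G i)"
    and H: "\<And>i. i \<in> I \<Longrightarrow> bounded_clinear (H i)"
    and uv: "(u, v) \<in> synthesis_relation I G H"
    and uv': "(u', v') \<in> synthesis_relation I G H"
  shows "(u + u', v + v') \<in> synthesis_relation I G H"
proof -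
  obtain J T where J: "finite J" "J \<subseteq> I"
    and u: "u = (\<Sum>i\<in>J. cadjoint (G i) (T i))" and v: "v = (\<Sum>i\<in>J. cadjoint (H i) (T i))"
    using uv by (auto simp: synthesis_relation_def)
  obtain J' T' where J': "finite J'" "J' \<subseteq> I"
    and u': "u' = (\<Sum>i\<in>J'. cadjoint (G i) (T' i))" and v': "v' = (\<Sum>i\<in>J'. cadjoint (H i) (T' i))"
    using uv' by (auto simp: synthesis_relation_def)
  \<comment> \<open>Coefficient families on different index sets are added after extension by zero.\<close>
  define S where "S i = (if i \<in> J then T i else 0) + (if i \<in> J' then T' i else 0)" for i
  have "(\<Sum>i\<in>J \<union> J'. cadjoint (F i) (S i))
      = (\<Sum>i\<in>J. cadjoint (F i) (T i)) + (\<Sum>i\<in>J'. cadjoint (F i) (T' i))"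
    if F: "\<And>i. i \<in> I \<Longrightarrow> bounded_clinear (F i)" for F :: "'i \<Rightarrow> 'h \<Rightarrow> 'k"
  proof -
    have "(\<Sum>i\<in>J \<union> J'. cadjoint (F i) (S i))
        = (\<Sum>i\<in>J \<union> J'. (if i \<in> J then cadjoint (F i) (T i) else 0)
            + (if i \<in> J' then cadjoint (F i) (T' i) else 0))"
    proof (rule sum.cong)
      fix i assume "i \<in> J \<union> J'"
      then have "bounded_clinear (F i)"
        using J J' F by blast
      then show "cadjoint (F i) (S i) = (if i \<in> J then cadjoint (F i) (T i) else 0)
            + (if i \<in> J' then cadjoint (F i) (T' i) else 0)"
        by (simp add: S_def cadjoint_add cadjoint_zero)
    qed simp
    also have "\<dots> = (\<Sum>i\<in>J. cadjoint (F i) (T i)) + (\<Sum>i\<in>J'. cadjoint (F i) (T' i))"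
      using J(1) J'(1)
      by (simp add: sum.distrib sum.If_cases Int_absorb1 Int_absorb2 Un_Int_distrib2 Int_Un_distrib2)
    finally show ?thesis .
  qed
  from this [OF G] this [OF H] show ?thesis
    unfolding synthesis_relation_def u u' v v'
    using J J' by (intro CollectI exI [of _ "J \<union> J'"] exI [of _ S]) auto
qed

lemma synthesis_relation_scaleC:
  fixes G H :: "'i \<Rightarrow> 'h::chilbert_space \<Rightarrow> 'k::complex_inner"
  assumes G: "\<And>i. i \<in> I \<Longrightarrow> bounded_clinear (G i)"
    and H: "\<And>i. i \<in> I \<Longrightarrow> bounded_clinear (H i)"
    and uv: "(u, v) \<in> synthesis_relation I G H"
  shows "(c *\<^sub>C u, c *\<^sub>C v) \<in> synthesis_relation I G H"
proof -
  obtain J T where J: "finite J" "J \<subseteq> I"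
    and u: "u = (\<Sum>i\<in>J. cadjoint (G i) (T i))" and v: "v = (\<Sum>i\<in>J. cadjoint (H i) (T i))"
    using uv by (auto simp: synthesis_relation_def)
  have "c *\<^sub>C (\<Sum>i\<in>J. cadjoint (F i) (T i)) = (\<Sum>i\<in>J. cadjoint (F i) (c *\<^sub>C T i))"
    if F: "\<And>i. i \<in> I \<Longrightarrow> bounded_clinear (F i)" for F :: "'i \<Rightarrow> 'h \<Rightarrow> 'k"
    unfolding cvs.scale_sum_right
    using J(2) F by (intro sum.cong) (auto simp: cadjoint_scaleC subset_iff)
  from this [OF G] this [OF H] show ?thesis
    unfolding synthesis_relation_def u v
    using J by (intro CollectI exI [of _ J] exI [of _ "\<lambda>i. c *\<^sub>C T i"]) auto
qed

lemma synthesis_relation_single: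
  assumes "i \<in> I"
  shows "(cadjoint (G i) t, cadjoint (H i) t) \<in> synthesis_relation I G H"
  unfolding synthesis_relation_def
  using assms by (intro CollectI exI [of _ "{i}"] exI [of _ "\<lambda>_. t"]) auto

text \<open>
  A vector \<open>z\<close> orthogonal to all \<open>G\<^sub>i\<^sup>* t\<close> satisfies \<open>G\<^sub>i z = 0\<close> for all \<open>i\<close>, so the lower frame bound
  forces \<open>z = 0\<close>.
\<close>

lemma hs_frame_synthesis_dense:
  fixes G H :: "'i \<Rightarrow> 'h::chilbert_space \<Rightarrow> 'k::chilbert_space hs"
  assumes frame: "hs_frame I G A B"
    and H: "\<And>i. i \<in> I \<Longrightarrow> bounded_clinear (H i)"
  shows "closure (fst ` synthesis_relation I G H) = UNIV"
proof -
  let ?R = "synthesis_relation I G H"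
  have G: "\<And>i. i \<in> I \<Longrightarrow> bounded_clinear (G i)" and A: "0 < A"
    and lo: "\<And>x. A * (norm x)\<^sup>2 \<le> (\<Sum>\<^sub>\<infinity>i\<in>I. (norm (G i x))\<^sup>2)"
    using frame by (auto simp: hs_frame_def)
  show ?thesis
  proof (rule dense_subspaceI)
    show "cvs.subspace (fst ` ?R)"
    proof (rule cvs.subspaceI)
      show "0 \<in> fst ` ?R"
        using synthesis_relation_zero [of I G H] by force
      show "x + y \<in> fst ` ?R" if "x \<in> fst ` ?R" "y \<in> fst ` ?R" for x y
        using that synthesis_relation_add [of I G H, OF G H] by (force simp: image_iff)
      show "c *\<^sub>C x \<in> fst ` ?R" if "x \<in> fst ` ?R" for c x
        using that synthesis_relation_scaleC [of I G H, OF G H] by (force simp: image_iff)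
    qed
  next
    fix z assume orth: "\<And>s. s \<in> fst ` ?R \<Longrightarrow> cinner z s = 0"
    have "G i z = 0" if i: "i \<in> I" for i
    proof (rule cinner_left_eqI)
      fix t
      have "cadjoint (G i) t \<in> fst ` ?R"
        using synthesis_relation_single [OF i, of G t H] by force
      then show "cinner (G i z) t = cinner 0 t"
        using orth by (simp add: cadjoint [OF G [OF i]])
    qed
    then have "(\<Sum>\<^sub>\<infinity>i\<in>I. (norm (G i z))\<^sup>2) = 0"
      by (intro infsum_0) simp
    then show "z = 0"
      using lo [of z] A by (simp add: mult_le_0_iff)
  qed
qed

text \<open>
  The perturbed family factors as \<open>H\<^sub>i = G\<^sub>i L\<^sup>*\<close>, where \<open>L\<close> is the extension of
  \<open>\<Sum> G\<^sub>i\<^sup>* T\<^sub>i \<mapsto> \<Sum> H\<^sub>i\<^sup>* T\<^sub>i\<close>. Hence both frame bounds are those of \<open>G\<close> times the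
  squared bounds for \<open>L\<^sup>*\<close>.
\<close>

lemma hs_frame_linear_perturbation:
  fixes G H :: "'i \<Rightarrow> 'h::chilbert_space \<Rightarrow> 'k::chilbert_space hs"
  assumes frame: "hs_frame I G A B"
    and H: "\<And>i. i \<in> I \<Longrightarrow> bounded_clinear (H i)"
    and p: "0 \<le> p" "p < 1" and q: "0 \<le> q" "q < 1"
    and near: "\<And>J T. finite J \<Longrightarrow> J \<subseteq> I \<Longrightarrow>
      norm ((\<Sum>i\<in>J. cadjoint (G i) (T i)) - (\<Sum>i\<in>J. cadjoint (H i) (T i)))
        \<le> p * norm (\<Sum>i\<in>J. cadjoint (G i) (T i)) + q * norm (\<Sum>i\<in>J. cadjoint (H i) (T i))"
  shows "hs_frame I H (A * ((1 - p) / (1 + q))\<^sup>2) (B * ((1 + p) / (1 - q))\<^sup>2)"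
proof -
  let ?R = "synthesis_relation I G H"
  have G: "\<And>i. i \<in> I \<Longrightarrow> bounded_clinear (G i)"
    using frame by (auto simp: hs_frame_def)
  have near': "norm (u - v) \<le> p * norm u + q * norm v" if "(u, v) \<in> ?R" for u v
    using that near by (auto simp: synthesis_relation_def)
  have bound: "norm v \<le> (1 + p) / (1 - q) * norm u" if "(u, v) \<in> ?R" for u v
  proof -
    have "(1 - q) * norm v \<le> (1 + p) * norm u"
      using near' [OF that] norm_triangle_ineq2 [of v u]
      by (simp add: algebra_simps norm_minus_commute)
    then show ?thesis
      using q by (simp add: field_simps)
  qed
  obtain L where L: "bounded_clinear L" and graph: "\<And>u. (u, L u) \<in> closure ?R"
    and LR: "\<And>u v. (u, v) \<in> ?R \<Longrightarrow> L u = v"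
    using bounded_clinear_of_dense_relation [OF synthesis_relation_zero [of I G H]
        synthesis_relation_add [OF G H]
        synthesis_relation_scaleC [OF G H] bound hs_frame_synthesis_dense [OF frame H]]
    by metis
  have "closed {x :: 'h \<times> 'h. norm (fst x - snd x) \<le> p * norm (fst x) + q * norm (snd x)}"
    by (intro closed_Collect_le continuous_intros)
  then have "closure ?R \<subseteq> {x. norm (fst x - snd x) \<le> p * norm (fst x) + q * norm (snd x)}"
    using near' by (intro closure_minimal) auto
  then have nearL: "norm (u - L u) \<le> p * norm u + q * norm (L u)" for u
    using graph [of u] by auto
  have factor: "H i x = G i (cadjoint L x)" if i: "i \<in> I" for i x
  proof (rule cinner_right_eqI [symmetric])
    fix t
    have "cinner t (G i (cadjoint L x)) = cinner (L (cadjoint (G i) t)) x"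
      by (simp add: cadjoint [OF L] cadjoint_swap [OF G [OF i]])
    also have "\<dots> = cinner t (H i x)"
      by (simp add: LR [OF synthesis_relation_single [OF i]] cadjoint_swap [OF H [OF i]])
    finally show "cinner t (G i (cadjoint L x)) = cinner t (H i x)" .
  qed
  show ?thesis
    using p q
    by (intro hs_frame_compose [OF frame H factor] divide_pos_pos
        norm_cadjoint_near_identity [OF L nearL]) auto
qed

theorem theorem4p7:
  fixes I :: "'i set"
    and G H :: "'i \<Rightarrow> 'h::chilbert_space \<Rightarrow> 'k::chilbert_space hs"
    and A B \<alpha> \<beta> l1 l2 :: real
  assumes "separable_space (euclidean :: 'h topology)"
    and "separable_space (euclidean :: 'k topology)"
    and "countable I"
    and "hs_frame I G A B"
    and "\<And>i. i \<in> I \<Longrightarrow> bounded_clinear (H i)"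
    and "0 < \<alpha>" "\<alpha> < 1" "0 < \<beta>" "\<beta> < 1" "\<alpha> + \<beta> = 1"
    and "0 \<le> l1" "0 \<le> l2" "max l1 l2 < 1"
    and "\<And>(J :: 'i set) (T :: 'i \<Rightarrow> 'k hs). finite J \<Longrightarrow> J \<subseteq> I \<Longrightarrow>
      norm (\<Sum>i\<in>J. cadjoint (G i) (T i) - cadjoint (H i) (T i))
        \<le> l1 * norm (\<Sum>i\<in>J. cadjoint (G i) (T i)) powr \<alpha>
              * norm (\<Sum>i\<in>J. cadjoint (H i) (T i)) powr \<beta>
          + l2 * norm (\<Sum>i\<in>J. cadjoint (G i) (T i)) powr \<beta>
              * norm (\<Sum>i\<in>J. cadjoint (H i) (T i)) powr \<alpha>"
  shows "hs_frame I H
    (A * ((1 - \<alpha> * l1 - \<beta> * l2) / (1 + \<beta> * l1 + \<alpha> * l2))\<^sup>2)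
    (B * ((1 + \<alpha> * l1 + \<beta> * l2) / (1 - \<beta> * l1 - \<alpha> * l2))\<^sup>2)"
proof -
  note frame = assms(4) and H = assms(5) and near = assms(14)
  have \<alpha>: "0 < \<alpha>" and \<beta>: "0 < \<beta>" and sum1: "\<alpha> + \<beta> = 1"
    and l: "0 \<le> l1" "0 \<le> l2" "l1 < 1" "l2 < 1"
    using assms(6-13) by auto
  define p q where "p = \<alpha> * l1 + \<beta> * l2" and "q = \<beta> * l1 + \<alpha> * l2"
  have convex: "a * l1 + b * l2 < 1" if "0 < a" "0 < b" "a + b = 1" for a b
    using that l mult_strict_left_mono [of l1 1 a] mult_strict_left_mono [of l2 1 b] by linarith
  have p: "0 \<le> p" "p < 1" and q: "0 \<le> q" "q < 1"
    using l \<alpha> \<beta> sum1 convex [of \<alpha> \<beta>] convex [of \<beta> \<alpha>] by (simp_all add: p_def q_def)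
  \<comment> \<open>The cases with a zero are separate: there the left side is \<open>0\<close> because \<open>0 powr a = 0\<close>.\<close>
  have young: "x powr a * y powr b \<le> a * x + b * y"
    if "0 \<le> x" "0 \<le> y" "0 < a" "0 < b" "a + b = 1" for x y a b :: real
    using that Youngs_inequality_0 [of a b x y] by (cases "x = 0 \<or> y = 0") auto
  have "hs_frame I H (A * ((1 - p) / (1 + q))\<^sup>2) (B * ((1 + p) / (1 - q))\<^sup>2)"
  proof (rule hs_frame_linear_perturbation [OF frame H p q])
    fix J and T :: "'i \<Rightarrow> 'k hs" assume J: "finite J" "J \<subseteq> I"
    define g h where "g = (\<Sum>i\<in>J. cadjoint (G i) (T i))" and "h = (\<Sum>i\<in>J. cadjoint (H i) (T i))"
    have "norm (g - h) \<le> l1 * (norm g powr \<alpha> * norm h powr \<beta>) + l2 * (norm g powr \<beta> * norm h powr \<alpha>)"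
      using near [OF J, of T] by (simp add: g_def h_def sum_subtractf mult.assoc)
    also have "\<dots> \<le> l1 * (\<alpha> * norm g + \<beta> * norm h) + l2 * (\<beta> * norm g + \<alpha> * norm h)"
      using l \<alpha> \<beta> sum1 by (intro add_mono mult_left_mono young) auto
    also have "\<dots> = p * norm g + q * norm h"
      by (simp add: p_def q_def algebra_simps)
    finally show "norm ((\<Sum>i\<in>J. cadjoint (G i) (T i)) - (\<Sum>i\<in>J. cadjoint (H i) (T i)))
        \<le> p * norm (\<Sum>i\<in>J. cadjoint (G i) (T i)) + q * norm (\<Sum>i\<in>J. cadjoint (H i) (T i))"
      by (simp add: g_def h_def)
  qed
  then show ?thesis
    by (simp add: p_def q_def algebra_simps)
qed

end
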